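(* For all integers $m\ge1$ and all $\lambda,\mu>0$, $$Q_{2m}(\lambda,\mu)=\sum_{r=0}^{2m}\sum_{i=0}^{r}\sum_{j=0}^{2m-r}(-1)^r\binom{2m}{r}\lambda^i\mu^j\,s(r,i)\,s(2m-r,j).$$ Therefore $Q_{2m}(\lambda,\mu)$ is a polynomial of degree $2m$.
   Context: For $\nu\ge 0$, $I_\nu(z)=2^{-\nu}z^\nu\sum_{k=0}^\infty \frac{4^{-k}z^{2k}}{k!\,\Gamma(\nu+k+1)}$ is the modified Bessel function, and $I_{-k}=I_k$ for integers $k$. For $p\ge 0$, $\theta>0$, $\beta>0$: $F_3(p;\theta,\beta)=\sum_{k=-\infty}^{\infty}|k|^p\theta^kI_k(\beta)$. For $m=1,2,3,\dots$ and $\lambda,\mu>0$: $Q_{2m}(\lambda,\mu)=\exp(-\lambda-\mu)\,F_3\left(2m;\sqrt{\lambda/\mu},\,2\sqrt{\lambda\mu}\right)$. $s(n,r)$ are the Stirling numbers of the second kind, defined by $x^n=\sum_{r=0}^ns(n,r)\,x(x-1)\cdots(x-r+1)$ (the empty product for $r=0$ being $1$). *)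

theory Defs
  imports
    "HOL-Analysis.Analysis"
    "HOL-Computational_Algebra.Polynomial"
    "HOL-Combinatorics.Stirling"
begin

(* Real power x^a for x \<ge> 0 and a \<ge> 0 with the usual convention 0^0 = 1
   (whereas 0 powr 0 = 0). *)
definition rpow :: "real \<Rightarrow> real \<Rightarrow> real" where
  "rpow x a = (if a = 0 then 1 else x powr a)"

(* The modified Bessel function I_\<nu>(z), for \<nu> \<ge> 0 and real z \<ge> 0. *)
definition bessel_I :: "real \<Rightarrow> real \<Rightarrow> real" where
  "bessel_I \<nu> z = 2 powr (-\<nu>) * rpow z \<nu> *
     (\<Sum>k. 4 powi (- int k) * z ^ (2 * k) / (fact k * Gamma (\<nu> + real k + 1)))"

(* Integer index, with I_{-k} = I_k. *)
definition bessel_I_int :: "int \<Rightarrow> real \<Rightarrow> real" where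
  "bessel_I_int k z = bessel_I (of_int \<bar>k\<bar>) z"

definition F3 :: "real \<Rightarrow> real \<Rightarrow> real \<Rightarrow> real" where
  "F3 p \<theta> \<beta> = (\<Sum>\<^sub>\<infinity>k\<in>(UNIV::int set). rpow (of_int \<bar>k\<bar>) p * \<theta> powi k * bessel_I_int k \<beta>)"

(* Q_even m is Q_{2m}; Q is only defined at even indices. *)
definition Q_even :: "nat \<Rightarrow> real \<Rightarrow> real \<Rightarrow> real" where
  "Q_even m lam mu = exp (-lam - mu) * F3 (real (2 * m)) (sqrt (lam / mu)) (2 * sqrt (lam * mu))"

(* The library's Stirling numbers of the second kind are given by a recurrence;
   this is their characterisation through falling factorials. *)
lemma power_eq_sum_Stirling:
  fixes x :: "'a::comm_ring_1"
  shows "x ^ n = (\<Sum>r\<le>n. of_nat (Stirling n r) * (\<Prod>k<r. x - of_nat k))"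
proof (induction n)
  case 0
  then show ?case by simp
next
  case (Suc n)
  define f where "f r = (\<Prod>k<r. x - of_nat k)" for r
  have xf: "x * f r = f (Suc r) + of_nat r * f r" for r
    by (simp add: f_def algebra_simps)
  have "(\<Sum>r\<le>Suc n. of_nat (Stirling (Suc n) r) * f r)
      = (\<Sum>r\<le>n. of_nat (Stirling (Suc n) (Suc r)) * f (Suc r))"
    by (subst sum.atMost_Suc_shift) simp
  also have "\<dots> = (\<Sum>r\<le>n. of_nat (Suc r) * of_nat (Stirling n (Suc r)) * f (Suc r))
      + (\<Sum>r\<le>n. of_nat (Stirling n r) * f (Suc r))"
    by (simp add: sum.distrib[symmetric] algebra_simps)
  also have "(\<Sum>r\<le>n. of_nat (Suc r) * of_nat (Stirling n (Suc r)) * f (Suc r))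
      = (\<Sum>r\<le>Suc n. of_nat r * of_nat (Stirling n r) * f r)"
    by (subst sum.atMost_Suc_shift) simp
  also have "\<dots> = (\<Sum>r\<le>n. of_nat r * of_nat (Stirling n r) * f r)"
    by simp
  also have "\<dots> + (\<Sum>r\<le>n. of_nat (Stirling n r) * f (Suc r))
      = (\<Sum>r\<le>n. of_nat (Stirling n r) * (x * f r))"
    unfolding xf by (simp add: sum.distrib[symmetric] algebra_simps)
  also have "\<dots> = x * (\<Sum>r\<le>n. of_nat (Stirling n r) * f r)"
    by (simp add: sum_distrib_left mult.left_commute)
  also have "\<dots> = x ^ Suc n"
    using Suc.IH by (simp add: f_def)
  finally show ?case by (simp add: f_def)
qed

(* A polynomial in two variables (x, y) is represented by P :: 'a poly poly, where
   coeff (coeff P i) j is the coefficient of x^i y^j. *)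
definition poly_eval2 :: "'a::comm_semiring_0 poly poly \<Rightarrow> 'a \<Rightarrow> 'a \<Rightarrow> 'a" where
  "poly_eval2 P x y = poly (poly P [:x:]) y"

definition total_degree2 :: "'a::zero poly poly \<Rightarrow> nat" where
  "total_degree2 P = Max (insert 0 {i + j | i j. coeff (coeff P i) j \<noteq> 0})"

end

(* If X and Y are independent Poisson variables with means lam and mu, then grouping the pairs
   (a, b) by k = a - b turns the Bessel series into the law of X - Y (the Skellam distribution),
   so Q_{2m} is the 2m-th moment of X - Y, equivalently of Y - X. Expanding (Y - X)^{2m} binomially and expressing Poisson
   moments through factorial moments, E[X(X-1)...(X-r+1)] = lam^r, gives the formula.
   The degree 2m is attained because only the r = 0 term contributes to mu^{2m}, with coefficient 1. *)
theory Submission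
  imports Defs
begin

section \<open>Unordered sums and Poisson moments\<close>

lemma has_sum_sum:
  fixes f :: "'a \<Rightarrow> 'b \<Rightarrow> 'c::topological_comm_monoid_add"
  assumes "\<And>i. i \<in> I \<Longrightarrow> (f i has_sum s i) A"
  shows "((\<lambda>x. \<Sum>i\<in>I. f i x) has_sum (\<Sum>i\<in>I. s i)) A"
  using assms by (induction I rule: infinite_finite_induct) (auto intro: has_sum_add)

text \<open>For real families summability is absolute. The iterated sums of absolute values are
  finite, so the product family is summable on \<open>A \<times> B\<close>, and its value may then
  be computed by iterated summation.\<close>

lemma has_sum_mult_real_Times:
  fixes f :: "'a \<Rightarrow> real" and g :: "'b \<Rightarrow> real"
  assumes f: "(f has_sum s) A" and g: "(g has_sum t) B"
  shows "((\<lambda>(x, y). f x * g y) has_sum s * t) (A \<times> B)"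
proof -
  have "(\<lambda>x. \<bar>f x\<bar>) summable_on A" "(\<lambda>y. \<bar>g y\<bar>) summable_on B"
    using f g summable_on_iff_abs_summable_on_real[of f A] summable_on_iff_abs_summable_on_real[of g B]
    by (auto dest: has_sum_imp_summable)
  then obtain t' where g': "((\<lambda>y. \<bar>g y\<bar>) has_sum t') B" and f': "(\<lambda>x. \<bar>f x\<bar>) summable_on A"
    by (auto simp: summable_on_def)
  have "(\<lambda>(x, y). \<bar>f x\<bar> * \<bar>g y\<bar>) summable_on A \<times> B"
    by (rule summable_on_SigmaI[where g = "\<lambda>x. \<bar>f x\<bar> * t'"])
       (auto intro: has_sum_cmult_right[OF g'] summable_on_cmult_left[OF f'])
  then have "(\<lambda>(x, y). f x * g y) summable_on A \<times> B"
    by (subst summable_on_iff_abs_summable_on_real) (simp add: case_prod_unfold abs_mult)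
  then show ?thesis
    by (intro has_sum_SigmaI[where g = "\<lambda>x. f x * t"])
       (auto intro: has_sum_cmult_right[OF g] has_sum_cmult_left[OF f])
qed

text \<open>Up to the factor \<open>exp x\<close>, this is the r-th factorial moment of a Poisson
  variable. The first \<open>r\<close> terms contain a zero factor; in the others the falling
  factorial cancels against the factorial, leaving \<open>x ^ r\<close> times the exponential
  series.\<close>

lemma falling_factorial_exp_sums:
  fixes x :: real
  shows "(\<lambda>n. (\<Prod>k<r. real n - real k) * (x ^ n / fact n)) sums (x ^ r * exp x)"
proof -
  let ?f = "\<lambda>n. (\<Prod>k<r. real n - real k) * (x ^ n / fact n)"
  have "?f (n + r) = x ^ r * (x ^ n /\<^sub>R fact n)" for n
  proof -
    have "(\<Prod>k<r. real (n + r) - real k) * fact n = fact (n + r)"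
    proof (induction r)
      case (Suc r)
      \<comment> \<open>The factor \<open>k = 0\<close> is split off instead of the last one: in the
        rest, index and argument both drop by one, which gives the product for
        \<open>r\<close>.\<close>
      have "(\<Prod>k<Suc r. real (n + Suc r) - real k) = real (n + Suc r) * (\<Prod>k<r. real (n + r) - real k)"
        by (simp add: prod.lessThan_Suc_shift del: prod.lessThan_Suc)
      with Suc show ?case
        by (simp add: mult.assoc)
    qed simp
    then have "(\<Prod>k<r. real (n + r) - real k) = fact (n + r) / fact n"
      by (simp add: field_simps)
    then show ?thesis
      by (simp add: power_add field_simps)
  qed
  then have "(\<lambda>n. ?f (n + r)) sums (x ^ r * exp x)"
    using sums_mult[OF exp_converges[of x], of "x ^ r"] by simp
  moreover have "?f i = 0" if "i < r" for i
    using that by auto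
  ultimately show ?thesis
    by (subst (asm) sums_zero_iff_shift)
qed

text \<open>Expanding \<open>n ^ p\<close> in falling factorials reduces this to factorial moments.
  With \<open>x \<ge> 0\<close> all terms are nonnegative, so the ordered series is also an
  unordered sum.\<close>

lemma power_exp_has_sum:
  fixes x :: real
  assumes "x \<ge> 0"
  shows "((\<lambda>n. real n ^ p * (x ^ n / fact n)) has_sum exp x * (\<Sum>r\<le>p. real (Stirling p r) * x ^ r)) UNIV"
proof -
  have "(\<lambda>n. \<Sum>r\<le>p. real (Stirling p r) * ((\<Prod>k<r. real n - real k) * (x ^ n / fact n)))
      sums (\<Sum>r\<le>p. real (Stirling p r) * (x ^ r * exp x))"
    by (intro sums_sum sums_mult falling_factorial_exp_sums)
  moreover have "(\<Sum>r\<le>p. real (Stirling p r) * ((\<Prod>k<r. real n - real k) * (x ^ n / fact n)))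
      = real n ^ p * (x ^ n / fact n)" for n
    unfolding power_eq_sum_Stirling[of "real n" p] by (simp add: sum_distrib_right sum_divide_distrib mult.assoc)
  ultimately have "(\<lambda>n. real n ^ p * (x ^ n / fact n)) sums (exp x * (\<Sum>r\<le>p. real (Stirling p r) * x ^ r))"
    by (simp add: sum_distrib_left mult_ac)
  then show ?thesis
    by (rule sums_nonneg_imp_has_sum) (use assms in auto)
qed

text \<open>The p-th moment of \<open>Y - X\<close> for independent Poisson \<open>X\<close>,
  \<open>Y\<close> with means \<open>x\<close>, \<open>y\<close>. The two inner sums are the Poisson
  moments (Touchard polynomials).\<close>

definition skellam_poly :: "nat \<Rightarrow> real \<Rightarrow> real \<Rightarrow> real" where
  "skellam_poly p x y = (\<Sum>r\<le>p. real (p choose r) * (-1) ^ r *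
     ((\<Sum>i\<le>r. real (Stirling r i) * x ^ i) * (\<Sum>j\<le>p - r. real (Stirling (p - r) j) * y ^ j)))"

text \<open>Each term of the binomial expansion is a function of \<open>a\<close> times a function
  of \<open>b\<close>, so its double sum factors into two Poisson moments.\<close>

lemma diff_power_exp_has_sum:
  fixes x y :: real
  assumes "x \<ge> 0" "y \<ge> 0"
  shows "((\<lambda>(a, b). (real b - real a) ^ p * (x ^ a / fact a * (y ^ b / fact b)))
    has_sum exp (x + y) * skellam_poly p x y) UNIV"
proof -
  let ?S = "\<lambda>p x. \<Sum>i\<le>p. real (Stirling p i) * x ^ i"
  have "((\<lambda>ab. \<Sum>r\<le>p. (real (p choose r) * (-1) ^ r) *
        (case ab of (a, b) \<Rightarrow> (real a ^ r * (x ^ a / fact a)) * (real b ^ (p - r) * (y ^ b / fact b))))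
      has_sum (\<Sum>r\<le>p. (real (p choose r) * (-1) ^ r) * ((exp x * ?S r x) * (exp y * ?S (p - r) y))))
      (UNIV \<times> UNIV)"
    by (intro has_sum_sum has_sum_cmult_right has_sum_mult_real_Times power_exp_has_sum assms)
  also have "(\<lambda>ab. \<Sum>r\<le>p. (real (p choose r) * (-1) ^ r) *
        (case ab of (a, b) \<Rightarrow> (real a ^ r * (x ^ a / fact a)) * (real b ^ (p - r) * (y ^ b / fact b))))
      = (\<lambda>(a, b). (real b - real a) ^ p * (x ^ a / fact a * (y ^ b / fact b)))"
  proof
    fix ab :: "nat \<times> nat"
    obtain a b where ab: "ab = (a, b)"
      by (cases ab)
    have "(real b - real a) ^ p = (\<Sum>r\<le>p. real (p choose r) * (- real a) ^ r * real b ^ (p - r))"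
      using binomial_ring[of "- real a" "real b" p] by simp
    also have "\<dots> * (x ^ a / fact a * (y ^ b / fact b)) = (\<Sum>r\<le>p. (real (p choose r) * (-1) ^ r) *
        ((real a ^ r * (x ^ a / fact a)) * (real b ^ (p - r) * (y ^ b / fact b))))"
      unfolding sum_distrib_right
      by (intro sum.cong refl) (subst power_minus, simp add: mult_ac)
    finally show "(\<Sum>r\<le>p. (real (p choose r) * (-1) ^ r) *
        (case ab of (a, b) \<Rightarrow> (real a ^ r * (x ^ a / fact a)) * (real b ^ (p - r) * (y ^ b / fact b))))
      = (case ab of (a, b) \<Rightarrow> (real b - real a) ^ p * (x ^ a / fact a * (y ^ b / fact b)))"
      unfolding ab prod.case by (rule sym)
  qed
  also have "(\<Sum>r\<le>p. (real (p choose r) * (-1) ^ r) * ((exp x * ?S r x) * (exp y * ?S (p - r) y)))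
      = exp (x + y) * skellam_poly p x y"
    unfolding skellam_poly_def sum_distrib_left
    by (intro sum.cong refl) (simp add: exp_add sum_distrib_left sum_distrib_right mult_ac)
  finally show ?thesis
    by simp
qed

section \<open>Bessel series as sums over pairs with fixed difference\<close>

lemma rpow_of_nat: "z > 0 \<or> n > 0 \<Longrightarrow> z \<ge> 0 \<Longrightarrow> rpow z (real n) = z ^ n"
  by (cases "z = 0") (auto simp: rpow_def powr_realpow)

lemma bessel_I_nat_has_sum:
  assumes "w > 0"
  shows "((\<lambda>n. w ^ L * (w\<^sup>2 ^ n / (fact n * fact (L + n)))) has_sum bessel_I (real L) (2 * w)) UNIV"
proof -
  let ?f = "\<lambda>n. w\<^sup>2 ^ n / (fact n * fact (L + n))"
  have "summable (\<lambda>n. w\<^sup>2 ^ n / fact n)"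
    using summable_exp[of "w\<^sup>2"] by (simp add: field_simps)
  \<comment> \<open>The extra denominator \<open>fact (L + n)\<close> is at least 1, so the
    exponential series dominates.\<close>
  then have "summable ?f"
    by (rule summable_comparison_test'[where N = 0])
       (auto simp: abs_mult intro!: divide_left_mono)
  then have "(?f has_sum suminf ?f) UNIV"
    by (intro sums_nonneg_imp_has_sum summable_sums) auto
  then have "((\<lambda>n. w ^ L * ?f n) has_sum w ^ L * suminf ?f) UNIV"
    by (rule has_sum_cmult_right)
  moreover have "bessel_I (real L) (2 * w) = w ^ L * suminf ?f"
  proof -
    have "4 powi (- int k) * (2 * w) ^ (2 * k) / (fact k * Gamma (real L + real k + 1)) = ?f k" for k
    proof -
      have "Gamma (real L + real k + 1) = fact (L + k)"
        using Gamma_fact[of "L + k", where 'a = real] by (simp add: add_ac)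
      moreover have "4 powi (- int k) * (2 * w) ^ (2 * k) = w\<^sup>2 ^ k"
        by (simp add: power_int_minus power_mult power_mult_distrib)
      ultimately show ?thesis by simp
    qed
    moreover have "2 powr (- real L) * rpow (2 * w) (real L) = w ^ L"
      using assms by (simp add: rpow_of_nat powr_minus powr_realpow power_mult_distrib)
    ultimately show ?thesis
      by (simp add: bessel_I_def)
  qed
  ultimately show ?thesis by simp
qed

text \<open>The pairs \<open>(nat k + n, nat (- k) + n)\<close> are exactly the pairs of naturals
  with difference \<open>k\<close>, so this is the unnormalised Skellam probability of
  \<open>k\<close>.\<close>

lemma skellam_density_has_sum:
  assumes "x > 0" "y > 0"
  shows "((\<lambda>n. x ^ (nat k + n) / fact (nat k + n) * (y ^ (nat (- k) + n) / fact (nat (- k) + n)))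
    has_sum sqrt (x / y) powi k * bessel_I_int k (2 * sqrt (x * y))) UNIV"
proof -
  define L where "L = nat \<bar>k\<bar>"
  have L: "of_int \<bar>k\<bar> = real L" by (simp add: L_def)
  have pos: "sqrt (x * y) > 0" and sq: "(sqrt (x * y))\<^sup>2 = x * y"
    using assms by auto
  have x: "sqrt (x / y) * sqrt (x * y) = x" and y: "sqrt (x * y) / sqrt (x / y) = y"
    using assms by (simp_all add: real_sqrt_mult real_sqrt_divide)
  \<comment> \<open>The two roots have product \<open>x\<close>, and the second divided by the first
    is \<open>y\<close>; which of these appears depends on the sign of \<open>k\<close>, and the
    other power has exponent 0.\<close>
  have weight: "sqrt (x / y) powi k * sqrt (x * y) ^ L = x ^ nat k * y ^ nat (- k)"
  proof (cases "k \<ge> 0")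
    case True
    then have "sqrt (x / y) powi k * sqrt (x * y) ^ L = (sqrt (x / y) * sqrt (x * y)) ^ L"
      by (simp add: L_def power_int_def power_mult_distrib)
    with True show ?thesis unfolding x by (simp add: L_def)
  next
    case False
    then have "sqrt (x / y) powi k * sqrt (x * y) ^ L = (sqrt (x * y) / sqrt (x / y)) ^ L"
      by (simp add: L_def power_int_def power_divide field_simps del: real_sqrt_power real_sqrt_divide)
    with False show ?thesis unfolding y by (simp add: L_def)
  qed
  have "((\<lambda>n. sqrt (x / y) powi k *
        (sqrt (x * y) ^ L * ((sqrt (x * y))\<^sup>2 ^ n / (fact n * fact (L + n)))))
      has_sum sqrt (x / y) powi k * bessel_I_int k (2 * sqrt (x * y))) UNIV"
    unfolding bessel_I_int_def L by (intro has_sum_cmult_right bessel_I_nat_has_sum pos)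
  also have "(\<lambda>n. sqrt (x / y) powi k *
        (sqrt (x * y) ^ L * ((sqrt (x * y))\<^sup>2 ^ n / (fact n * fact (L + n)))))
      = (\<lambda>n. x ^ (nat k + n) / fact (nat k + n) * (y ^ (nat (- k) + n) / fact (nat (- k) + n)))"
    unfolding sq mult.assoc[symmetric] weight
    by (cases "k \<ge> 0") (auto simp: L_def power_add power_mult_distrib mult_ac)
  finally show ?thesis .
qed

text \<open>The double sum over \<open>(a, b)\<close> is regrouped by \<open>k = a - b\<close>; each
  inner sum is then a Bessel term.\<close>

lemma F3_skellam:
  assumes "m \<ge> 1" "x > 0" "y > 0"
  shows "F3 (real (2 * m)) (sqrt (x / y)) (2 * sqrt (x * y)) = exp (x + y) * skellam_poly (2 * m) x y"
proof -
  let ?w = "\<lambda>a b. x ^ a / fact a * (y ^ b / fact b)"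
  have "((\<lambda>(k, n). real_of_int k ^ (2 * m) * ?w (nat k + n) (nat (- k) + n))
      has_sum exp (x + y) * skellam_poly (2 * m) x y) (UNIV \<times> UNIV)
    \<longleftrightarrow> ((\<lambda>(a, b). (real b - real a) ^ (2 * m) * ?w a b)
      has_sum exp (x + y) * skellam_poly (2 * m) x y) UNIV"
  proof (rule has_sum_reindex_bij_witness[where j = "\<lambda>(k, n). (nat k + n, nat (- k) + n)"
        and i = "\<lambda>(a, b). (int a - int b, min a b)"])
    fix kn :: "int \<times> nat"
    show "(case case kn of (k, n) \<Rightarrow> (nat k + n, nat (- k) + n) of
        (a, b) \<Rightarrow> (real b - real a) ^ (2 * m) * ?w a b)
      = (case kn of (k, n) \<Rightarrow> real_of_int k ^ (2 * m) * ?w (nat k + n) (nat (- k) + n))"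
    proof (cases kn)
      case (Pair k n)
      \<comment> \<open>Here \<open>b - a\<close> is \<open>- k\<close>; the even exponent absorbs
        the sign.\<close>
      have "(real (nat (- k)) - real (nat k)) ^ (2 * m) = (- real_of_int k) ^ (2 * m)"
        by (cases "k \<ge> 0") auto
      with Pair show ?thesis
        by simp
    qed
  qed (auto simp: min_def)
  with diff_power_exp_has_sum[of x y "2 * m"] assms
  have "((\<lambda>(k, n). real_of_int k ^ (2 * m) * ?w (nat k + n) (nat (- k) + n))
      has_sum exp (x + y) * skellam_poly (2 * m) x y) (UNIV \<times> UNIV)"
    by simp
  then have "((\<lambda>k. real_of_int k ^ (2 * m) * (sqrt (x / y) powi k * bessel_I_int k (2 * sqrt (x * y))))
      has_sum exp (x + y) * skellam_poly (2 * m) x y) UNIV"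
    by (rule has_sum_SigmaD)
       (simp only: prod.case, intro has_sum_cmult_right skellam_density_has_sum assms)
  moreover have "rpow (of_int \<bar>k\<bar>) (real (2 * m)) = real_of_int k ^ (2 * m)" for k
    by (subst rpow_of_nat) (use assms in \<open>auto simp: power_even_abs\<close>)
  ultimately show ?thesis
    unfolding F3_def by (intro infsumI) (simp add: mult.assoc)
qed

section \<open>The explicit polynomial and its degree\<close>

lemma skellam_poly_altdef:
  "skellam_poly p x y = (\<Sum>r=0..p. \<Sum>i=0..r. \<Sum>j=0..p-r.
     (-1) ^ r * real (p choose r) * x ^ i * y ^ j * real (Stirling r i) * real (Stirling (p-r) j))"
  unfolding skellam_poly_def sum_product atLeast0AtMost
  by (simp add: sum_distrib_left mult_ac)

text \<open>The formal counterpart of the triple sum, needed because total degree is read off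
  coefficients and not values.\<close>

definition skellam_poly2 :: "nat \<Rightarrow> real poly poly" where
  "skellam_poly2 p = (\<Sum>r=0..p. \<Sum>i=0..r. \<Sum>j=0..p-r.
     monom (monom ((-1) ^ r * real (p choose r) * real (Stirling r i) * real (Stirling (p-r) j)) j) i)"

lemma poly_eval2_sum: "poly_eval2 (\<Sum>i\<in>I. f i) x y = (\<Sum>i\<in>I. poly_eval2 (f i) x y)"
  by (simp add: poly_eval2_def poly_sum)

lemma poly_eval2_monom:
  fixes c x y :: "'a::comm_semiring_1"
  shows "poly_eval2 (monom (monom c j) i) x y = c * x ^ i * y ^ j"
  by (simp add: poly_eval2_def poly_monom mult_ac)

lemma poly_eval2_skellam_poly2: "poly_eval2 (skellam_poly2 p) x y = skellam_poly p x y"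
  unfolding skellam_poly2_def skellam_poly_altdef poly_eval2_sum poly_eval2_monom
  by (intro sum.cong refl) (simp add: mult_ac)

lemma coeff_skellam_poly2:
  "coeff (coeff (skellam_poly2 p) i) j = (\<Sum>r=0..p. if i \<le> r \<and> j \<le> p - r
     then (-1) ^ r * real (p choose r) * real (Stirling r i) * real (Stirling (p-r) j) else 0)"
proof -
  let ?c = "\<lambda>r i j. (-1) ^ r * real (p choose r) * real (Stirling r i) * real (Stirling (p-r) j)"
  have "coeff (coeff (skellam_poly2 p) i) j
      = (\<Sum>r=0..p. \<Sum>i'=0..r. \<Sum>j'=0..p-r. if i' = i then if j' = j then ?c r i' j' else 0 else 0)"
    unfolding skellam_poly2_def coeff_sum by (intro sum.cong refl) simp
  also have "\<dots> = (\<Sum>r=0..p. \<Sum>i'=0..r. if i' = i then \<Sum>j'=0..p-r. if j' = j then ?c r i' j' else 0 else 0)"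
    by (intro sum.cong refl) simp
  also have "\<dots> = (\<Sum>r=0..p. if i \<le> r \<and> j \<le> p - r then ?c r i j else 0)"
    by (intro sum.cong refl) (simp add: sum.delta)
  finally show ?thesis .
qed

text \<open>A nonzero coefficient needs some \<open>r\<close> with \<open>i \<le> r\<close> and
  \<open>j \<le> p - r\<close>, hence \<open>i + j \<le> p\<close>. The monomial
  \<open>y ^ p\<close> attains the bound.\<close>

lemma total_degree2_skellam_poly2: "total_degree2 (skellam_poly2 p) = p"
proof -
  let ?D = "insert 0 {i + j | i j. coeff (coeff (skellam_poly2 p) i) j \<noteq> 0}"
  have le: "d \<le> p" if d: "d \<in> ?D" for d
  proof (cases "d = 0")
    case False
    with d obtain i j where ij: "d = i + j" "coeff (coeff (skellam_poly2 p) i) j \<noteq> 0"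
      by auto
    then obtain r where "r \<in> {0..p}" "i \<le> r \<and> j \<le> p - r"
      unfolding coeff_skellam_poly2 by (auto elim!: sum.not_neutral_contains_not_neutral split: if_splits)
    with ij show ?thesis by auto
  qed simp
  \<comment> \<open>The condition \<open>p \<le> p - r\<close> with \<open>r \<le> p\<close> leaves
    only \<open>r = 0\<close>, where both Stirling numbers are 1.\<close>
  have "coeff (coeff (skellam_poly2 p) 0) p = (\<Sum>r=0..p. if r = 0 then 1 else 0)"
    unfolding coeff_skellam_poly2 by (intro sum.cong refl) auto
  then have "coeff (coeff (skellam_poly2 p) 0) p \<noteq> 0"
    by simp
  then have "p \<in> ?D"
    by force
  moreover have "finite ?D"
    using le by (meson finite_nat_set_iff_bounded_le)
  ultimately show ?thesis
    unfolding total_degree2_def by (intro Max_eqI le)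
qed

theorem mainTheorem6:
  fixes m :: nat
  assumes "m \<ge> 1"
  shows "(\<forall>lam>0. \<forall>mu>0. Q_even m lam mu =
            (\<Sum>r=0..2*m. \<Sum>i=0..r. \<Sum>j=0..2*m-r.
               (-1) ^ r * real ((2*m) choose r) * lam ^ i * mu ^ j
                 * real (Stirling r i) * real (Stirling (2*m-r) j)))
       \<and> (\<exists>P :: real poly poly. total_degree2 P = 2 * m
            \<and> (\<forall>lam>0. \<forall>mu>0. Q_even m lam mu = poly_eval2 P lam mu))"
proof -
  have Q: "Q_even m lam mu = skellam_poly (2 * m) lam mu" if "lam > 0" "mu > 0" for lam mu
  proof -
    have "exp (- lam - mu) * exp (lam + mu) = 1"
      by (simp flip: exp_add)
    then show ?thesis
      unfolding Q_even_def F3_skellam[OF assms that] by (simp flip: mult.assoc)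
  qed
  \<comment> \<open>The witness for \<open>P\<close> is
    \<open>skellam_poly2 (2 * m)\<close>.\<close>
  then show ?thesis
    using total_degree2_skellam_poly2 poly_eval2_skellam_poly2
    unfolding skellam_poly_altdef[symmetric] by metis
qed

end
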